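(* Let $m,i\in\mathbb{N}^*$ and let $(G_t)_{t\ge1}$ be the pure anti-preferential attachment random graph process with parameter $m$. Then $$\limsup_{t\to\infty}\frac{d(v_i,t)}{\ln t}<\infty\qquad\text{almost surely.}$$
   Context: $\mathbb{N}^*=\{1,2,\dots\}$. The pure anti-preferential attachment random graph process with parameter $m\in\mathbb{N}^*$ (the case $p=1$ of the paper's PA-APA model) is the following sequence $(G_t)_{t\ge1}$ of random undirected multigraphs, where $G_t$ has vertices $v_1,\dots,v_t$ and $mt$ edges. Let $d(v_i,t)$ denote the degree of $v_i$ in $G_t$ for $t\ge i$ (multiple edges are counted with multiplicity, and a self-loop contributes $2$), and $d(v_i,t)=0$ for $t<i$. Let $\mathcal{F}_t=\sigma(G_s: 1\le s\le t)$. $G_1$ consists of the single vertex $v_1$ with $m$ self-loops (so $d(v_1,1)=2m$). For each $t\ge1$, $G_{t+1}$ is obtained from $G_t$ by adding a new vertex $v_{t+1}$ and $m$ edges joining $v_{t+1}$ to vertices $W_{t+1}^1,\dots,W_{t+1}^m\in\{v_1,\dots,v_t\}$ (repetitions allowed, giving multiple edges), which, given $\mathcal{F}_t$, are chosen independently with $$\mathbb{P}(W_{t+1}^r=v_i\mid\mathcal{F}_t)=\frac{2mt+1-d(v_i,t)}{t(2mt+1-2m)},\qquad 1\le i\le t,\ 1\le r\le m.$$ *)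

theory Defs
  imports "HOL-Probability.Probability" "HOL-Library.Uprod"
begin

text \<open>Finite undirected multigraphs: an edge is an unordered pair, a self-loop at \<open>v\<close> being
  \<open>Upair v v\<close>, and multiple edges are recorded by the multiset of edges.\<close>

record 'v multigraph =
  verts :: "'v set"
  edges :: "'v uprod multiset"

definition degree :: "'v multigraph \<Rightarrow> 'v \<Rightarrow> nat" where
  "degree g v =
     (\<Sum>e\<in>#edges g. if e = Upair v v then 2 else if v \<in> set_uprod e then 1 else 0)"

definition attach :: "nat \<Rightarrow> 'v \<Rightarrow> (nat \<Rightarrow> 'v) \<Rightarrow> 'v multigraph \<Rightarrow> 'v multigraph" where
  "attach m u w g =
     \<lparr>verts = insert u (verts g),
      edges = edges g + {#Upair u (w r). r \<in># mset_set {1..m}#}\<rparr>"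

text \<open>The natural filtration of a random graph process indexed by \<open>1, 2, \<dots>\<close>; graphs carry the
  discrete sigma-algebra. Index \<open>0\<close> is not part of the process.\<close>

definition graph_filtration ::
  "'w measure \<Rightarrow> (nat \<Rightarrow> 'w \<Rightarrow> 'v multigraph) \<Rightarrow> nat \<Rightarrow> 'w measure" where
  "graph_filtration M G t = sigma (space M) {G s -` A \<inter> space M | s A. s \<in> {1..t}}"

definition prob_given :: "'w measure \<Rightarrow> 'w measure \<Rightarrow> 'w set \<Rightarrow> 'w \<Rightarrow> real" where
  "prob_given M F A = real_cond_exp M F (indicator A)"

text \<open>The vertex \<open>v\<^sub>i\<close> is represented by its index \<open>i \<ge> 1\<close>.\<close>

definition deg_at :: "(nat \<Rightarrow> 'w \<Rightarrow> nat multigraph) \<Rightarrow> nat \<Rightarrow> nat \<Rightarrow> 'w \<Rightarrow> nat" where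
  "deg_at G i t \<omega> = (if t < i then 0 else degree (G t \<omega>) i)"

locale pure_apa_process = prob_space M
  for M :: "'w measure" +
  fixes m :: nat
    and G :: "nat \<Rightarrow> 'w \<Rightarrow> nat multigraph"
    and W :: "nat \<Rightarrow> nat \<Rightarrow> 'w \<Rightarrow> nat"
  assumes m_pos: "m \<ge> 1"
    and G_measurable: "\<And>t. t \<ge> 1 \<Longrightarrow> G t \<in> measurable M (count_space UNIV)"
    and W_measurable: "\<And>t r. t \<ge> 1 \<Longrightarrow> r \<in> {1..m} \<Longrightarrow>
      W (Suc t) r \<in> measurable M (count_space UNIV)"
    and W_range: "\<And>t r \<omega>. t \<ge> 1 \<Longrightarrow> r \<in> {1..m} \<Longrightarrow> \<omega> \<in> space M \<Longrightarrow>
      W (Suc t) r \<omega> \<in> {1..t}"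
    and G_initial: "\<And>\<omega>. \<omega> \<in> space M \<Longrightarrow>
      G 1 \<omega> = \<lparr>verts = {1}, edges = replicate_mset m (Upair 1 1)\<rparr>"
    and G_step: "\<And>t \<omega>. t \<ge> 1 \<Longrightarrow> \<omega> \<in> space M \<Longrightarrow>
      G (Suc t) \<omega> = attach m (Suc t) (\<lambda>r. W (Suc t) r \<omega>) (G t \<omega>)"
    and W_cond_law: "\<And>t r i. t \<ge> 1 \<Longrightarrow> r \<in> {1..m} \<Longrightarrow> i \<in> {1..t} \<Longrightarrow>
      AE \<omega> in M.
        prob_given M (graph_filtration M G t) {\<omega> \<in> space M. W (Suc t) r \<omega> = i} \<omega> =
          (2 * real m * real t + 1 - real (deg_at G i t \<omega>)) /
          (real t * (2 * real m * real t + 1 - 2 * real m))"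
    and W_cond_indep: "\<And>t A. t \<ge> 1 \<Longrightarrow>
      AE \<omega> in M.
        prob_given M (graph_filtration M G t)
          {\<omega> \<in> space M. \<forall>r\<in>{1..m}. W (Suc t) r \<omega> \<in> A r} \<omega> =
        (\<Prod>r\<in>{1..m}. prob_given M (graph_filtration M G t)
          {\<omega> \<in> space M. W (Suc t) r \<omega> \<in> A r} \<omega>)"

end

theory Submission
  imports Defs
begin

text \<open>For \<open>t \<ge> i\<close>, the degree \<open>d(t)\<close> of the vertex \<open>i\<close> grows by \<open>N = card {r. W (Suc t) r = i}\<close> at the step from
  \<open>t\<close> to \<open>t + 1\<close>, and every choice \<open>W (Suc t) r\<close> hits \<open>i\<close> with conditional probability at most
  \<open>2 / t\<close>, whatever \<open>d(t)\<close> is (lemma \<open>attachment_probability_le\<close>). Since \<open>N \<le> m\<close>, we have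
  \<open>2 ^ N \<le> 1 + 2 ^ m * N\<close>; taking conditional expectations yields
  \<open>E (2 ^ d(t + 1)) \<le> (1 + a / t) * E (2 ^ d(t))\<close> with \<open>a = m * 2 ^ (m + 1)\<close>
  (lemma \<open>expectation_two_power_step\<close>). By Bernoulli's inequality \<open>1 + a / t \<le> ((t + 1) / t) ^ a\<close>,
  so that the exponential moment \<open>E (2 ^ d(t))\<close> is at most \<open>C * t ^ a\<close> for a constant \<open>C\<close>. Markov's
  inequality bounds the probability of \<open>2 ^ d(t) \<ge> t ^ (a + 2)\<close> by \<open>C / t\<^sup>2\<close>, which is summable, and
  the Borel-Cantelli lemma shows that almost surely \<open>d(t) \<le> (a + 2) / ln 2 * ln t\<close> for all large
  \<open>t\<close>.\<close>

section \<open>Degrees in multigraphs\<close>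

lemma degree_attach_old_vertex:
  assumes "v \<noteq> u"
  shows "degree (attach m u w g) v = degree g v + card {r\<in>{1..m}. w r = v}"
proof -
  have "degree (attach m u w g) v = degree g v +
      (\<Sum>r\<in>{1..m}. if Upair u (w r) = Upair v v then 2 else if v \<in> set_uprod (Upair u (w r)) then 1 else 0)"
    by (simp add: degree_def attach_def sum_unfold_sum_mset multiset.map_comp comp_def)
  also have "(\<Sum>r\<in>{1..m}. if Upair u (w r) = Upair v v then 2
        else if v \<in> set_uprod (Upair u (w r)) then 1 else 0)
      = (\<Sum>r\<in>{1..m}. if w r = v then 1 else (0::nat))"
    using assms by (intro sum.cong) auto
  also have "\<dots> = card {r\<in>{1..m}. w r = v}"
    by (simp add: sum.If_cases Int_def)
  finally show ?thesis .
qed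

lemma degree_le_size_edges: "degree g v \<le> 2 * size (edges g)"
proof -
  have "(\<Sum>e\<in>#E. if e = Upair v v then 2 else if v \<in> set_uprod e then 1 else 0) \<le> 2 * size E"
    for E :: "'a uprod multiset"
    by (induction E) auto
  then show ?thesis by (simp add: degree_def)
qed

text \<open>A bound on the exponential increment that is linear in \<open>card R\<close>, so that its expectation needs
  only the probabilities of the single events \<open>r \<in> R\<close>.\<close>

lemma two_power_card_le:
  assumes "R \<subseteq> {1..m::nat}"
  shows "(2::real) ^ card R \<le> 1 + 2 ^ m * real (card R)"
proof (cases "R = {}")
  case False
  have fin: "finite R" using assms finite_subset by blast
  have "card R \<le> m" using card_mono[OF _ assms] by simp
  then have "(2::real) ^ card R \<le> 2 ^ m" by (intro power_increasing) auto
  also have "\<dots> \<le> 2 ^ m * real (card R)"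
    using False fin by (simp add: Suc_le_eq card_gt_0_iff)
  finally show ?thesis by simp
qed simp

section \<open>Measurability and growth of the degree process\<close>

context pure_apa_process
begin

lemma subalgebra_graph_filtration: "subalgebra M (graph_filtration M G t)"
  and measurable_graph_filtration:
    "t \<ge> 1 \<Longrightarrow> G t \<in> measurable (graph_filtration M G t) (count_space UNIV)"
proof -
  let ?A = "{G s -` A \<inter> space M | s A. s \<in> {1..t}}"
  have gen: "?A \<subseteq> sets M"
  proof clarify
    fix s :: nat and A assume "s \<in> {1..t}"
    then show "G s -` A \<inter> space M \<in> sets M"
      using measurable_sets[OF G_measurable, of s A] by simp
  qed
  then show "subalgebra M (graph_filtration M G t)"
    unfolding subalgebra_def graph_filtration_def
    by (simp add: sets_measure_of_conv space_measure_of_conv sets.sigma_sets_subset)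
  have pow: "?A \<subseteq> Pow (space M)" by auto
  show "G t \<in> measurable (graph_filtration M G t) (count_space UNIV)" if "t \<ge> 1"
  proof (rule measurableI)
    fix A :: "nat multigraph set"
    have "G t -` A \<inter> space M \<in> ?A" using that by auto
    then show "G t -` A \<inter> space (graph_filtration M G t) \<in> sets (graph_filtration M G t)"
      using pow by (simp add: graph_filtration_def space_measure_of_conv sigma_sets.Basic)
  qed simp
qed

lemma deg_at_measurable_filtration:
  assumes "t \<ge> 1"
  shows "deg_at G i t \<in> measurable (graph_filtration M G t) (count_space UNIV)"
proof -
  have "(\<lambda>g. if t < i then 0 else degree g i) \<circ> G t
      \<in> measurable (graph_filtration M G t) (count_space UNIV)"
    by (rule measurable_comp[OF measurable_graph_filtration[OF assms]]) simp
  then show ?thesis by (simp add: deg_at_def[abs_def] comp_def)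
qed

lemma deg_at_measurable:
  assumes "t \<ge> 1"
  shows "deg_at G i t \<in> measurable M (count_space UNIV)"
  using measurable_from_subalg[OF subalgebra_graph_filtration deg_at_measurable_filtration[OF assms]] .

lemma size_edges:
  assumes "t \<ge> 1" "\<omega> \<in> space M"
  shows "size (edges (G t \<omega>)) = m * t"
  using assms(1)
proof (induction t rule: dec_induct)
  case base
  then show ?case using G_initial[OF assms(2)] by simp
next
  case (step t)
  then show ?case using G_step[OF step(1) assms(2)] by (simp add: attach_def)
qed

lemma deg_at_le:
  assumes "t \<ge> 1" "\<omega> \<in> space M"
  shows "deg_at G i t \<omega> \<le> 2 * m * t"
  using degree_le_size_edges[of "G t \<omega>" i] size_edges[OF assms] by (simp add: deg_at_def)

lemma deg_at_Suc:
  assumes "i \<ge> 1" "i \<le> t" "\<omega> \<in> space M"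
  shows "deg_at G i (Suc t) \<omega> = deg_at G i t \<omega> + card {r\<in>{1..m}. W (Suc t) r \<omega> = i}"
  using assms G_step[of t \<omega>] by (simp add: deg_at_def degree_attach_old_vertex)

lemma integrable_two_power_deg_at:
  assumes "t \<ge> 1"
  shows "integrable M (\<lambda>\<omega>. (2::real) ^ deg_at G i t \<omega>)"
proof (rule integrable_const_bound[where B = "2 ^ (2 * m * t)"])
  show "AE \<omega> in M. norm ((2::real) ^ deg_at G i t \<omega>) \<le> 2 ^ (2 * m * t)"
    using deg_at_le[OF assms] by (intro AE_I2) (simp add: power_increasing)
  show "(\<lambda>\<omega>. (2::real) ^ deg_at G i t \<omega>) \<in> borel_measurable M"
    by (rule measurable_compose[OF deg_at_measurable[OF assms]]) simp
qed

section \<open>Exponential moments of the degree\<close>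

text \<open>For \<open>t \<ge> 2\<close> the factor \<open>2 m t + 1 - 2 m\<close> of the denominator is at least half of \<open>2 m t + 1\<close>;
  at \<open>t = 1\<close> the only vertex has degree \<open>2 m\<close>, and the bound holds because the probability is \<open>1\<close>.\<close>

lemma attachment_probability_le:
  assumes "t \<ge> 1" "i \<in> {1..t}" "\<omega> \<in> space M"
  shows "(2 * real m * real t + 1 - real (deg_at G i t \<omega>)) /
      (real t * (2 * real m * real t + 1 - 2 * real m)) \<le> 2 / real t"
proof (cases "t = 1")
  case True
  have "degree (G 1 \<omega>) 1 = 2 * m"
    using G_initial[OF assms(3)] by (simp add: degree_def)
  then show ?thesis using True assms(2) by (simp add: deg_at_def)
next
  case False
  then have "2 \<le> real t" using assms(1) by simp
  then have "2 * real m \<le> real m * real t" using mult_left_mono[of 2 "real t" "real m"] by simp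
  then have pos: "2 * real m * real t + 1 - 2 * real m > 0"
    and le: "2 * real m * real t + 1 - real (deg_at G i t \<omega>)
      \<le> 2 * (2 * real m * real t + 1 - 2 * real m)" by auto
  have "(2 * real m * real t + 1 - real (deg_at G i t \<omega>)) /
      (2 * real m * real t + 1 - 2 * real m) \<le> 2"
    using pos le by (simp add: pos_divide_le_eq)
  from divide_right_mono[OF this, of "real t"] show ?thesis
    by (simp add: mult.commute)
qed

text \<open>The weight \<open>2 ^ deg_at G i t\<close> is measurable with respect to the graphs up to time \<open>t\<close>, so the
  indicator of a hit may be replaced by its conditional probability.\<close>

lemma expectation_two_power_hit_le:
  assumes "t \<ge> 1" "i \<in> {1..t}" "r \<in> {1..m}"
  shows "expectation (\<lambda>\<omega>. 2 ^ deg_at G i t \<omega> * indicator {\<omega>\<in>space M. W (Suc t) r \<omega> = i} \<omega>)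
      \<le> 2 / real t * expectation (\<lambda>\<omega>. 2 ^ deg_at G i t \<omega>)"
    and "integrable M
      (\<lambda>\<omega>. (2::real) ^ deg_at G i t \<omega> * indicator {\<omega>\<in>space M. W (Suc t) r \<omega> = i} \<omega>)"
proof -
  let ?F = "graph_filtration M G t"
  let ?A = "{\<omega>\<in>space M. W (Suc t) r \<omega> = i}"
  let ?f = "\<lambda>\<omega>. (2::real) ^ deg_at G i t \<omega>"
  interpret finite_measure_subalgebra M ?F
    by unfold_locales (rule subalgebra_graph_filtration)
  have A: "?A \<in> sets M"
    using measurable_sets[OF W_measurable[OF assms(1,3)], of "{i}"]
    by (simp add: vimage_def Int_def conj_commute)
  show int: "integrable M (\<lambda>\<omega>. ?f \<omega> * indicator ?A \<omega>)"
    by (rule integrable_mult_indicator[OF A integrable_two_power_deg_at[OF assms(1)],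
        simplified mult.commute real_scaleR_def])
  have meas: "?f \<in> borel_measurable ?F"
    by (rule measurable_compose[OF deg_at_measurable_filtration[OF assms(1)]]) simp
  have "expectation (\<lambda>\<omega>. ?f \<omega> * indicator ?A \<omega>)
      = expectation (\<lambda>\<omega>. ?f \<omega> * real_cond_exp M ?F (indicator ?A) \<omega>)"
    using real_cond_exp_intg(2)[OF int meas] A by simp
  also have "\<dots> \<le> expectation (\<lambda>\<omega>. ?f \<omega> * (2 / real t))"
  proof (rule integral_mono_AE)
    show "integrable M (\<lambda>\<omega>. ?f \<omega> * real_cond_exp M ?F (indicator ?A) \<omega>)"
      using real_cond_exp_intg(1)[OF int meas] A by simp
    show "integrable M (\<lambda>\<omega>. ?f \<omega> * (2 / real t))"
      using integrable_two_power_deg_at[OF assms(1)] by simp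
    show "AE \<omega> in M. ?f \<omega> * real_cond_exp M ?F (indicator ?A) \<omega> \<le> ?f \<omega> * (2 / real t)"
      using W_cond_law[OF assms(1,3,2)] AE_space
    proof eventually_elim
      case (elim \<omega>)
      then show ?case
        using attachment_probability_le[OF assms(1,2), of \<omega>]
        by (intro mult_left_mono) (simp_all add: prob_given_def)
    qed
  qed
  also have "\<dots> = 2 / real t * expectation ?f" by simp
  finally show "expectation (\<lambda>\<omega>. ?f \<omega> * indicator ?A \<omega>) \<le> 2 / real t * expectation ?f" .
qed

lemma expectation_two_power_step:
  assumes "i \<ge> 1" "i \<le> t"
  shows "expectation (\<lambda>\<omega>. 2 ^ deg_at G i (Suc t) \<omega>)
      \<le> (1 + real (m * 2 ^ (m + 1)) / real t) * expectation (\<lambda>\<omega>. 2 ^ deg_at G i t \<omega>)"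
proof -
  let ?f = "\<lambda>\<omega>. (2::real) ^ deg_at G i t \<omega>"
  let ?h = "\<lambda>r \<omega>. ?f \<omega> * indicator {\<omega>\<in>space M. W (Suc t) r \<omega> = i} \<omega>"
  have t: "t \<ge> 1" "i \<in> {1..t}" using assms by auto
  note hit = expectation_two_power_hit_le[OF t]
  have intf: "integrable M ?f" by (rule integrable_two_power_deg_at[OF t(1)])
  have ints: "integrable M (\<lambda>\<omega>. \<Sum>r\<in>{1..m}. ?h r \<omega>)"
    using hit(2) by (intro Bochner_Integration.integrable_sum) auto
  have "expectation (\<lambda>\<omega>. 2 ^ deg_at G i (Suc t) \<omega>)
      \<le> expectation (\<lambda>\<omega>. ?f \<omega> + 2 ^ m * (\<Sum>r\<in>{1..m}. ?h r \<omega>))"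
  proof (rule integral_mono)
    show "integrable M (\<lambda>\<omega>. (2::real) ^ deg_at G i (Suc t) \<omega>)"
      by (rule integrable_two_power_deg_at) simp
    show "integrable M (\<lambda>\<omega>. ?f \<omega> + 2 ^ m * (\<Sum>r\<in>{1..m}. ?h r \<omega>))"
      using intf ints by simp
    fix \<omega> assume \<omega>: "\<omega> \<in> space M"
    let ?R = "{r\<in>{1..m}. W (Suc t) r \<omega> = i}"
    have "real (card ?R) = (\<Sum>r\<in>{1..m}. indicator {\<omega>\<in>space M. W (Suc t) r \<omega> = i} \<omega>)"
      using \<omega> by (simp add: indicator_def sum.If_cases Int_def)
    then have h: "(\<Sum>r\<in>{1..m}. ?h r \<omega>) = ?f \<omega> * real (card ?R)"
      by (simp add: sum_distrib_left)
    have "(2::real) ^ deg_at G i (Suc t) \<omega> = ?f \<omega> * 2 ^ card ?R"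
      using deg_at_Suc[OF assms \<omega>] by (simp add: power_add)
    also have "\<dots> \<le> ?f \<omega> * (1 + 2 ^ m * real (card ?R))"
      by (intro mult_left_mono two_power_card_le) auto
    finally show "(2::real) ^ deg_at G i (Suc t) \<omega> \<le> ?f \<omega> + 2 ^ m * (\<Sum>r\<in>{1..m}. ?h r \<omega>)"
      unfolding h by (simp add: algebra_simps)
  qed
  also have "\<dots> = expectation ?f + 2 ^ m * (\<Sum>r\<in>{1..m}. expectation (?h r))"
  proof -
    have "expectation (\<lambda>\<omega>. \<Sum>r\<in>{1..m}. ?h r \<omega>) = (\<Sum>r\<in>{1..m}. expectation (?h r))"
      using hit(2) by (rule Bochner_Integration.integral_sum)
    moreover have "expectation (\<lambda>\<omega>. ?f \<omega> + 2 ^ m * (\<Sum>r\<in>{1..m}. ?h r \<omega>))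
        = expectation ?f + 2 ^ m * expectation (\<lambda>\<omega>. \<Sum>r\<in>{1..m}. ?h r \<omega>)"
      using Bochner_Integration.integral_add[OF intf integrable_mult_right[OF ints, of "2 ^ m"]]
      by (simp only: integral_mult_right_zero)
    ultimately show ?thesis by simp
  qed
  also have "(\<Sum>r\<in>{1..m}. expectation (?h r)) \<le> (\<Sum>r\<in>{1..m}. 2 / real t * expectation ?f)"
    using hit(1) by (intro sum_mono) auto
  finally show ?thesis by (simp add: algebra_simps)
qed

lemma expectation_two_power_le:
  assumes "i \<ge> 1" "i \<le> t"
  shows "expectation (\<lambda>\<omega>. 2 ^ deg_at G i t \<omega>)
      \<le> expectation (\<lambda>\<omega>. 2 ^ deg_at G i i \<omega>) * real t ^ (m * 2 ^ (m + 1))"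
  using assms(2)
proof (induction t rule: dec_induct)
  case base
  have "0 \<le> expectation (\<lambda>\<omega>. (2::real) ^ deg_at G i i \<omega>)" by simp
  moreover have "1 \<le> real i ^ (m * 2 ^ (m + 1))"
    using assms(1) by (intro one_le_power) simp
  ultimately show ?case by (metis mult.right_neutral mult_left_mono)
next
  case (step t)
  define a where "a = m * 2 ^ (m + 1)"
  let ?C = "expectation (\<lambda>\<omega>. (2::real) ^ deg_at G i i \<omega>)"
  have t: "real t > 0" using step(1) assms(1) by simp
  have C: "0 \<le> ?C" by simp
  have "1 + real a * (1 / real t) \<le> (1 + 1 / real t) ^ a"
    by (rule Bernoulli_inequality, rule order_trans[of _ 0]) auto
  also have "1 + 1 / real t = real (Suc t) / real t"
    using t by (simp add: field_simps)
  finally have bern: "(1 + real a / real t) * real t ^ a \<le> real (Suc t) ^ a"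
    using t by (simp add: power_divide pos_le_divide_eq)
  have "expectation (\<lambda>\<omega>. 2 ^ deg_at G i (Suc t) \<omega>)
      \<le> (1 + real a / real t) * expectation (\<lambda>\<omega>. 2 ^ deg_at G i t \<omega>)"
    using expectation_two_power_step[OF assms(1) step(1)] by (simp add: a_def)
  also have "\<dots> \<le> (1 + real a / real t) * (?C * real t ^ a)"
    using step(3) t by (intro mult_left_mono) (simp_all add: a_def)
  also have "\<dots> = ?C * ((1 + real a / real t) * real t ^ a)" by simp
  also have "\<dots> \<le> ?C * real (Suc t) ^ a"
    using bern C by (rule mult_left_mono)
  finally show ?case by (simp add: a_def)
qed

section \<open>Almost sure logarithmic growth\<close>

lemma AE_eventually_two_power_less:
  assumes "i \<ge> 1"
  shows "AE \<omega> in M. \<forall>\<^sub>F t in sequentially.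
      (2::real) ^ deg_at G i t \<omega> < real t ^ (m * 2 ^ (m + 1) + 2)"
proof -
  define a where "a = m * 2 ^ (m + 1)"
  define C where "C = expectation (\<lambda>\<omega>. (2::real) ^ deg_at G i i \<omega>)"
  \<comment> \<open>The index is shifted by \<open>i\<close> because the moment bound holds from time \<open>i\<close> on.\<close>
  define B where "B t = {\<omega>\<in>space M. real (t + i) ^ (a + 2) \<le> (2::real) ^ deg_at G i (t + i) \<omega>}" for t
  have pos: "real (t + i) > 0" for t using assms by simp
  have int: "integrable M (\<lambda>\<omega>. (2::real) ^ deg_at G i (t + i) \<omega>)" for t
    using assms by (intro integrable_two_power_deg_at) simp
  have "prob (B t) \<le> C * (1 / real (t + i) ^ 2)" for t
  proof -
    have "prob (B t) \<le> expectation (\<lambda>\<omega>. 2 ^ deg_at G i (t + i) \<omega>) / real (t + i) ^ (a + 2)"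
      unfolding B_def using int pos[of t]
      by (intro integral_Markov_inequality_measure[where A = "{}"]) simp_all
    also have "\<dots> \<le> C * real (t + i) ^ a / real (t + i) ^ (a + 2)"
      using expectation_two_power_le[OF assms, of "t + i"]
      by (intro divide_right_mono) (simp_all add: C_def a_def)
    also have "\<dots> = C * (1 / real (t + i) ^ 2)"
      using pos[of t] by (simp add: power_add power2_eq_square)
    finally show ?thesis .
  qed
  then have bound: "norm (prob (B t)) \<le> C * (1 / real (t + i) ^ 2)" for t by simp
  have "summable (\<lambda>n. 1 / real n ^ 2)"
    using inverse_power_summable[of 2, where 'a = real] by (simp add: inverse_eq_divide)
  \<comment> \<open>The exponent \<open>a + 2\<close> leaves \<open>1 / t\<^sup>2\<close> after division of the moment bound.\<close>
  from summable_mult[OF summable_ignore_initial_segment[OF this]]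
  have "summable (\<lambda>t. C * (1 / real (t + i) ^ 2))" .
  from summable_comparison_test'[OF this bound] have "summable (\<lambda>t. prob (B t))" .
  moreover have "B t \<in> sets M" for t
    unfolding B_def using borel_measurable_integrable[OF int[of t]] by measurable
  ultimately have "AE \<omega> in M. \<forall>\<^sub>F t in sequentially. \<omega> \<in> space M - B t"
    by (intro borel_cantelli_AE1) (auto simp: emeasure_eq_measure)
  then show ?thesis
  proof eventually_elim
    case (elim \<omega>)
    then have "\<forall>\<^sub>F t in sequentially.
        (2::real) ^ deg_at G i (t + i) \<omega> < real (t + i) ^ (a + 2)"
      by eventually_elim (auto simp: B_def)
    then show ?case
      unfolding a_def
      by (subst (asm) eventually_sequentially_seg)
  qed
qed

end

theorem theorem3p6:
  fixes M :: "'w measure" and m i :: nat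
    and G :: "nat \<Rightarrow> 'w \<Rightarrow> nat multigraph"
    and W :: "nat \<Rightarrow> nat \<Rightarrow> 'w \<Rightarrow> nat"
  assumes "pure_apa_process M m G W"
    and "i \<ge> 1"
  shows "AE \<omega> in M.
    limsup (\<lambda>t. ereal (real (deg_at G i t \<omega>) / ln (real t))) < \<infinity>"
proof -
  interpret pure_apa_process M m G W by fact
  define b where "b = m * 2 ^ (m + 1) + 2"
  show ?thesis
    using AE_eventually_two_power_less[OF assms(2)]
  proof eventually_elim
    case (elim \<omega>)
    have "\<forall>\<^sub>F t in sequentially.
        ereal (real (deg_at G i t \<omega>) / ln (real t)) \<le> ereal (real b / ln 2)"
      using elim eventually_ge_at_top[of 2]
    proof eventually_elim
      case (elim t)
      have "ln ((2::real) ^ deg_at G i t \<omega>) \<le> ln (real t ^ b)"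
        using elim by (subst ln_le_cancel_iff) (auto simp: b_def)
      then have "real (deg_at G i t \<omega>) * ln 2 \<le> real b * ln (real t)"
        using elim by (simp add: ln_realpow)
      moreover have "ln (real t) > 0" using elim by simp
      ultimately show ?case by (simp add: field_simps)
    qed
    then have "limsup (\<lambda>t. ereal (real (deg_at G i t \<omega>) / ln (real t))) \<le> ereal (real b / ln 2)"
      by (rule Limsup_bounded)
    then show ?case by (rule le_less_trans) simp
  qed
qed

end
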